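(* Consider the one-pile game with stones of weight $1$ (Type 1) and weight $2$ (Type 2), in which a player facing a pile of total weight $m$ removes a nonempty collection of stones of total weight at most $\lfloor m/2\rfloor$, and a player who cannot move loses. Denote by $(x,y)$ the position with $x$ Type 2 stones and $y$ Type 1 stones. Then the set $$\mathcal{P}=\bigcup_{n=1}^{\infty}\big(\mathcal{P}_{n,1}\cup\mathcal{P}_{n,2}\cup\mathcal{P}_{n,3}\big)$$ is the set of $\mathcal{P}$-positions of this game.
   Context: $\mathbb{Z}_{\ge 0}$ is the set of non-negative integers and $\mathbb{N}=\{1,2,3,\dots\}$ is the set of natural numbers. The game: there is one pile containing stones of two types, Type 1 stones of weight $1$ and Type 2 stones of weight $2$. Two players take turns removing stones. A position is a pair $(x,y)\in\mathbb{Z}_{\ge 0}^2$, where $x$ is the number of Type 2 stones and $y$ is the number of Type 1 stones; its total weight is $2x+y$. The positions reachable in one move from $(x,y)$ are $$\mathrm{move}(x,y)=\Big\{(x-t,y-u): t,u\in\mathbb{Z}_{\ge 0},\ t\le x,\ u\le y,\ 1\le 2t+u\le \Big\lfloor \frac{2x+y}{2}\Big\rfloor\Big\}.$$ A player who cannot move loses (the player who makes the last move wins). A position is a $\mathcal{P}$-position if it is a winning position for the previous player (the player who just moved), as long as that player plays correctly at every stage, and an $\mathcal{N}$-position if it is a winning position for the next player, as long as that player plays correctly at every stage. For $n\in\mathbb{N}$, $$\mathcal{P}_{n,1}=\{(2^n-1,0)\},$$ $$\mathcal{P}_{n,2}=\{(2^n-i-1,\,2i-1): i\in\mathbb{N},\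 1\le i\le n-1\},$$ $$\mathcal{P}_{n,3}=\{(2^n-n-i,\,2n+2i-1): i\in\mathbb{N},\ 1\le i\le 2^n-n\}.$$ (In particular $\mathcal{P}_{1,2}=\emptyset$.)
   Formalization: The positions (0,0) and (0,1), which admit no move and so are P-positions but lie in none of the sets P_{n,1}, P_{n,2}, P_{n,3} with n ≥ 1, are added to the union; for all other positions the claim is unchanged. *)

theory Defs
  imports Main
begin

text \<open>A position is a pair \<open>(x, y)\<close>: \<open>x\<close> stones of weight 2 and \<open>y\<close> stones of weight 1.\<close>

type_synonym position = "nat \<times> nat"

fun move :: "position \<Rightarrow> position set" where
  "move (x, y) =
     {(x - t, y - u) | t u. t \<le> x \<and> u \<le> y \<and> 1 \<le> 2 * t + u \<and> 2 * t + u \<le> (2 * x + y) div 2}"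

text \<open>
  A complete play from \<open>p\<close>, listed by its successive positions. Every move lowers the total
  weight, so there are no infinite plays.
\<close>

definition play :: "position \<Rightarrow> position list \<Rightarrow> bool" where
  "play p ps \<longleftrightarrow> ps \<noteq> [] \<and> hd ps = p
     \<and> (\<forall>i. Suc i < length ps \<longrightarrow> ps ! Suc i \<in> move (ps ! i))
     \<and> move (last ps) = {}"

text \<open>A strategy must be legal wherever a move exists, so that it cannot win vacuously.\<close>

definition strategy :: "(position \<Rightarrow> position) \<Rightarrow> bool" where
  "strategy \<sigma> \<longleftrightarrow> (\<forall>q. move q \<noteq> {} \<longrightarrow> \<sigma> q \<in> move q)"

text \<open>
  The next player is to move at the positions of even index in a play, and the previous player
  at those of odd index.
\<close>

definition previous_follows :: "(position \<Rightarrow> position) \<Rightarrow> position list \<Rightarrow> bool" where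
  "previous_follows \<sigma> ps \<longleftrightarrow> (\<forall>i. odd i \<and> Suc i < length ps \<longrightarrow> ps ! Suc i = \<sigma> (ps ! i))"

text \<open>
  The loser is the player who is to move at the last position, so the previous player wins iff
  the last index is even.
\<close>

definition previous_wins :: "position list \<Rightarrow> bool" where
  "previous_wins ps \<longleftrightarrow> even (length ps - 1)"

definition P_position :: "position \<Rightarrow> bool" where
  "P_position p \<longleftrightarrow>
     (\<exists>\<sigma>. strategy \<sigma> \<and> (\<forall>ps. play p ps \<and> previous_follows \<sigma> ps \<longrightarrow> previous_wins ps))"

text \<open>For \<open>n \<ge> 1\<close> the ranges of \<open>i\<close> ensure that no subtraction below is truncated.\<close>

definition P1 :: "nat \<Rightarrow> position set" where
  "P1 n = {(2 ^ n - 1, 0)}"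

definition P2 :: "nat \<Rightarrow> position set" where
  "P2 n = {(2 ^ n - i - 1, 2 * i - 1) | i. 1 \<le> i \<and> i \<le> n - 1}"

definition P3 :: "nat \<Rightarrow> position set" where
  "P3 n = {(2 ^ n - n - i, 2 * n + 2 * i - 1) | i. 1 \<le> i \<and> i \<le> 2 ^ n - n}"

end

theory Submission
  imports Defs
begin

text \<open>
  A set \<open>K\<close> of positions is the set of P-positions as soon as it is a kernel of the move
  relation: no move leads from \<open>K\<close> to \<open>K\<close>, and every position outside \<open>K\<close> has a move into
  \<open>K\<close> (\<open>P_positions_eq_kernel\<close>). So it remains to check these two properties for the proposed set.

  The key to both is the total weight. Removing stones is a legal move from weight \<open>w\<close> to
  weight \<open>w'\<close> exactly when \<open>w' < w \<le> 2 * w'\<close>. The positions of level \<open>n\<close> have weight \<open>2 ^ (n + 1) - 2\<close>,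
  \<open>2 ^ (n + 1) - 3\<close> or \<open>2 ^ (n + 1) - 1\<close>, and the number \<open>y\<close> of light stones decides which: it is
  zero, odd and below \<open>2 * n - 1\<close>, or odd and above \<open>2 * n - 1\<close>, respectively. The two exceptional
  positions \<open>(0, 0)\<close> and \<open>(0, 1)\<close> form level \<open>0\<close>, so that levels are treated uniformly.

  Stability (\<open>cold_stable\<close>): the bound \<open>w \<le> 2 * w'\<close> rules out moves to a lower level, except that
  the weights \<open>2 ^ (n + 1) - 2\<close> and \<open>2 ^ (n + 1) - 3\<close> can be reduced to \<open>2 ^ n - 1\<close>, where too few
  light stones are available. Level \<open>0\<close> is terminal. Within a level \<open>n \<ge> 1\<close> the weight drops by at
  most \<open>2\<close>; from weight \<open>2 ^ (n + 1) - 1\<close> more light stones than that would have to go, and from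
  weight \<open>2 ^ (n + 1) - 2\<close> the target would have to contain a light stone where there was none.

  Absorption (\<open>cold_absorbing\<close>): if \<open>2 ^ (n + 1) \<le> w < 2 ^ (n + 2)\<close>, then either \<open>w\<close> is one of the
  last three weights, those of level \<open>n + 1\<close>, or level \<open>n\<close> can be reached. In the latter case, many
  light stones permit weight \<open>2 ^ (n + 1) - 1\<close>, while few light stones mean many heavy ones and
  permit one of the two smaller weights. When level \<open>n\<close> is out of reach, either the
  position itself belongs to level \<open>n + 1\<close> or removing one or two light stones leads there.
\<close>

section \<open>Kernels and winning strategies\<close>

lemma mem_move_iff:
  "(a, b) \<in> move (x, y) \<longleftrightarrow>
     a \<le> x \<and> b \<le> y \<and> 2 * a + b < 2 * x + y \<and> 2 * x + y \<le> 2 * (2 * a + b)"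
proof
  assume "(a, b) \<in> move (x, y)"
  then show "a \<le> x \<and> b \<le> y \<and> 2 * a + b < 2 * x + y \<and> 2 * x + y \<le> 2 * (2 * a + b)"
    by auto
next
  assume *: "a \<le> x \<and> b \<le> y \<and> 2 * a + b < 2 * x + y \<and> 2 * x + y \<le> 2 * (2 * a + b)"
  then have "(a, b) = (x - (x - a), y - (y - b))" and "x - a \<le> x" and "y - b \<le> y"
    and "1 \<le> 2 * (x - a) + (y - b)" and "2 * (x - a) + (y - b) \<le> (2 * x + y) div 2"
    by auto
  then show "(a, b) \<in> move (x, y)"
    unfolding move.simps by blast
qed

lemma move_decreases_weight:
  assumes "q \<in> move p"
  shows "2 * fst q + snd q < 2 * fst p + snd p"
  using assms by (cases p; cases q) (simp only: mem_move_iff fst_conv snd_conv)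

lemma play_Cons:
  assumes "q \<in> move p" and "play q qs"
  shows "play p (p # qs)"
proof -
  have qs: "qs \<noteq> []" "qs ! 0 = q" "move (last qs) = {}"
    and steps: "\<And>i. Suc i < length qs \<Longrightarrow> qs ! Suc i \<in> move (qs ! i)"
    using assms(2) by (auto simp: play_def hd_conv_nth)
  have "(p # qs) ! Suc i \<in> move ((p # qs) ! i)" if "Suc i < length (p # qs)" for i
    using that qs assms(1) steps by (cases i) auto
  then show ?thesis
    using qs by (simp add: play_def)
qed

text \<open>
  From a position outside the kernel the next player defeats any strategy of the opponent by always
  moving into the kernel; the losing play exists because the weight decreases.
\<close>

lemma losing_play_outside_kernel:
  assumes stable: "\<And>p q. p \<in> K \<Longrightarrow> q \<in> move p \<Longrightarrow> q \<notin> K"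
    and absorbing: "\<And>p. p \<notin> K \<Longrightarrow> \<exists>q\<in>move p. q \<in> K"
    and strat: "strategy \<sigma>"
    and "p \<notin> K"
  shows "\<exists>ps. play p ps \<and> previous_follows \<sigma> ps \<and> \<not> previous_wins ps"
  using \<open>p \<notin> K\<close>
proof (induction "2 * fst p + snd p" arbitrary: p rule: less_induct)
  case less
  obtain q where q: "q \<in> move p" "q \<in> K"
    using absorbing less.prems by blast
  show ?case
  proof (cases "move q = {}")
    case True
    then have "play q [q]"
      by (simp add: play_def)
    then have "play p [p, q]"
      using q(1) by (rule play_Cons[rotated])
    moreover have "previous_follows \<sigma> [p, q]"
      by (auto simp: previous_follows_def)
    ultimately show ?thesis
      by (intro exI[of _ "[p, q]"]) (simp add: previous_wins_def)
  next
    case False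
    define r where "r = \<sigma> q"
    have r: "r \<in> move q"
      using strat False unfolding strategy_def r_def by blast
    then have "r \<notin> K"
      using stable q(2) by blast
    moreover have "2 * fst r + snd r < 2 * fst p + snd p"
      using move_decreases_weight[OF r] move_decreases_weight[OF q(1)] by simp
    ultimately obtain ps where ps: "play r ps" "previous_follows \<sigma> ps" "\<not> previous_wins ps"
      using less.hyps by blast
    have hd: "ps \<noteq> []" "ps ! 0 = r"
      using ps(1) by (auto simp: play_def hd_conv_nth)
    have "play p (p # q # ps)"
      by (rule play_Cons[OF q(1) play_Cons[OF r ps(1)]])
    moreover have "previous_follows \<sigma> (p # q # ps)"
      unfolding previous_follows_def
    proof (intro allI impI, elim conjE)
      fix i :: nat
      assume i: "odd i" "Suc i < length (p # q # ps)"
      show "(p # q # ps) ! Suc i = \<sigma> ((p # q # ps) ! i)"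
      proof (cases "i = 1")
        case True
        then show ?thesis
          using hd by (simp add: r_def)
      next
        case False
        then obtain j where "i = Suc (Suc j)"
          using i(1) by (metis One_nat_def not0_implies_Suc even_zero)
        then show ?thesis
          using i ps(2) by (simp add: previous_follows_def)
      qed
    qed
    moreover have "\<not> previous_wins (p # q # ps)"
      using ps(3) hd(1) by (cases ps) (auto simp: previous_wins_def)
    ultimately show ?thesis
      by blast
  qed
qed

text \<open>
  In the kernel it is the previous player who answers every move by returning to the kernel. The
  positions of even index then lie in the kernel, those of odd index do not and hence are not
  terminal.
\<close>

lemma P_position_in_kernel:
  assumes stable: "\<And>p q. p \<in> K \<Longrightarrow> q \<in> move p \<Longrightarrow> q \<notin> K"
    and absorbing: "\<And>p. p \<notin> K \<Longrightarrow> \<exists>q\<in>move p. q \<in> K"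
    and "p \<in> K"
  shows "P_position p"
proof -
  (* Inside the kernel the choice of a move is irrelevant, but it has to be legal. *)
  define \<sigma> where
    "\<sigma> q = (if q \<in> K then SOME r. r \<in> move q else SOME r. r \<in> move q \<and> r \<in> K)" for q
  have into: "\<sigma> q \<in> move q \<and> \<sigma> q \<in> K" if "q \<notin> K" for q
    using someI_ex[of "\<lambda>r. r \<in> move q \<and> r \<in> K"] absorbing[OF that] that
    by (auto simp: \<sigma>_def)
  have "\<sigma> q \<in> move q" if "move q \<noteq> {}" for q
    using into[of q] that by (cases "q \<in> K") (auto simp: \<sigma>_def some_in_eq)
  then have "strategy \<sigma>"
    by (simp add: strategy_def)
  moreover have "previous_wins ps" if "play p ps" and "previous_follows \<sigma> ps" for ps
  proof -
    have ps: "ps \<noteq> []" "ps ! 0 = p" "move (ps ! (length ps - 1)) = {}"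
      and steps: "\<And>i. Suc i < length ps \<Longrightarrow> ps ! Suc i \<in> move (ps ! i)"
      using \<open>play p ps\<close> by (auto simp: play_def hd_conv_nth last_conv_nth)
    have parity: "i < length ps \<Longrightarrow> ps ! i \<in> K \<longleftrightarrow> even i" for i
    proof (induction i)
      case 0
      then show ?case
        using ps \<open>p \<in> K\<close> by simp
    next
      case (Suc i)
      show ?case
      proof (cases "even i")
        case True
        then have "ps ! i \<in> K"
          using Suc by simp
        then have "ps ! Suc i \<notin> K"
          using stable steps Suc.prems by blast
        then show ?thesis
          using True by simp
      next
        case False
        then have "ps ! i \<notin> K" and "ps ! Suc i = \<sigma> (ps ! i)"
          using Suc \<open>previous_follows \<sigma> ps\<close> by (auto simp: previous_follows_def)
        then show ?thesis
          using into False by simp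
      qed
    qed
    have "ps ! (length ps - 1) \<in> K"
      using absorbing ps(3) by blast
    then show ?thesis
      using parity[of "length ps - 1"] ps(1) by (simp add: previous_wins_def)
  qed
  ultimately show ?thesis
    unfolding P_position_def by blast
qed

lemma P_positions_eq_kernel:
  assumes "\<And>p q. p \<in> K \<Longrightarrow> q \<in> move p \<Longrightarrow> q \<notin> K"
    and "\<And>p. p \<notin> K \<Longrightarrow> \<exists>q\<in>move p. q \<in> K"
  shows "{p. P_position p} = K"
proof -
  have "p \<in> K" if winning: "P_position p" for p
  proof (rule ccontr)
    assume "p \<notin> K"
    obtain \<sigma> where \<sigma>: "strategy \<sigma>"
      "\<And>ps. play p ps \<Longrightarrow> previous_follows \<sigma> ps \<Longrightarrow> previous_wins ps"
      using winning unfolding P_position_def by blast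
    have "\<exists>ps. play p ps \<and> previous_follows \<sigma> ps \<and> \<not> previous_wins ps"
      by (rule losing_play_outside_kernel) (fact assms \<sigma>(1) \<open>p \<notin> K\<close>)+
    then show False
      using \<sigma>(2) by blast
  qed
  moreover have "P_position p" if "p \<in> K" for p
    by (rule P_position_in_kernel) (fact assms that)+
  ultimately show ?thesis
    by blast
qed

section \<open>The levels of the kernel\<close>

text \<open>
  Level \<open>n\<close> is described by the weight \<open>2 * x + y\<close> instead of a parameter; the equations for the
  weight force \<open>y\<close> to be odd in the last two cases.
\<close>

definition cold :: "nat \<Rightarrow> position set" where
  "cold n = {(x, y).
     y = 0 \<and> 2 * x + 2 = 2 ^ Suc n \<or>
     y + 3 \<le> 2 * n \<and> 2 * x + y + 3 = 2 ^ Suc n \<or>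
     2 * n + 1 \<le> y \<and> 2 * x + y + 1 = 2 ^ Suc n}"

lemma Suc_le_two_power: "Suc n \<le> 2 ^ n"
  by (rule Suc_leI) (rule less_exp)

lemma cold_eq: "P1 n \<union> P2 n \<union> P3 n = cold n"
proof (rule set_eqI, clarify)
  fix x y :: nat
  have n: "Suc n \<le> 2 ^ n"
    by (rule Suc_le_two_power)
  have 1: "(x, y) \<in> P1 n \<longleftrightarrow> y = 0 \<and> 2 * x + 2 = 2 ^ Suc n"
    using n by (auto simp: P1_def)
  have 2: "(x, y) \<in> P2 n \<longleftrightarrow> y + 3 \<le> 2 * n \<and> 2 * x + y + 3 = 2 ^ Suc n"
  proof
    assume "(x, y) \<in> P2 n"
    then show "y + 3 \<le> 2 * n \<and> 2 * x + y + 3 = 2 ^ Suc n"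
      using n by (auto simp: P2_def)
  next
    assume *: "y + 3 \<le> 2 * n \<and> 2 * x + y + 3 = 2 ^ Suc n"
    then have "odd y"
      unfolding power_Suc by presburger
    then obtain k where "y = 2 * k + 1"
      by (auto elim: oddE)
    with * have "x = 2 ^ n - Suc k - 1 \<and> y = 2 * Suc k - 1 \<and> 1 \<le> Suc k \<and> Suc k \<le> n - 1"
      by auto
    then show "(x, y) \<in> P2 n"
      unfolding P2_def by blast
  qed
  have 3: "(x, y) \<in> P3 n \<longleftrightarrow> 2 * n + 1 \<le> y \<and> 2 * x + y + 1 = 2 ^ Suc n"
  proof
    assume "(x, y) \<in> P3 n"
    then show "2 * n + 1 \<le> y \<and> 2 * x + y + 1 = 2 ^ Suc n"
      using n by (auto simp: P3_def)
  next
    assume *: "2 * n + 1 \<le> y \<and> 2 * x + y + 1 = 2 ^ Suc n"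
    define i where "i = 2 ^ n - n - x"
    have "x = 2 ^ n - n - i \<and> y = 2 * n + 2 * i - 1 \<and> 1 \<le> i \<and> i \<le> 2 ^ n - n"
      using * n by (auto simp: i_def)
    then show "(x, y) \<in> P3 n"
      unfolding P3_def by blast
  qed
  show "(x, y) \<in> P1 n \<union> P2 n \<union> P3 n \<longleftrightarrow> (x, y) \<in> cold n"
    unfolding Un_iff 1 2 3 by (auto simp: cold_def)
qed

lemma cold_0: "cold 0 = {(0, 0), (0, 1)}"
  by (auto simp: cold_def)

text \<open>
  Higher levels are too heavy to be reached, and levels below \<open>n - 1\<close> weigh less than half as
  much as level \<open>n\<close>. Where the weights permit a move to level \<open>n\<close> or \<open>n - 1\<close>, the numbers of
  light stones prevent it.
\<close>

lemma cold_stable: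
  assumes p: "p \<in> cold n" and q: "q \<in> move p"
  shows "q \<notin> cold m"
proof
  assume qm: "q \<in> cold m"
  obtain x y a b where pq: "p = (x, y)" "q = (a, b)"
    by (cases p; cases q)
  have mv: "a \<le> x" "b \<le> y" "2 * a + b < 2 * x + y" "2 * x + y \<le> 4 * a + 2 * b"
    using q unfolding pq mem_move_iff by simp_all
  define N M :: nat where "N = 2 ^ n" and "M = 2 ^ m"
  have N: "n + 1 \<le> N" and M: "m + 1 \<le> M"
    using Suc_le_two_power[of n] Suc_le_two_power[of m] by (simp_all add: N_def M_def)
  have p_cases: "y = 0 \<and> x + 1 = N \<or> y + 3 \<le> 2 * n \<and> 2 * x + y + 3 = 2 * N
      \<or> 2 * n + 1 \<le> y \<and> 2 * x + y + 1 = 2 * N"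
    using p by (auto simp: pq cold_def N_def)
  have q_cases: "b = 0 \<and> a + 1 = M \<or> 1 \<le> b \<and> b + 3 \<le> 2 * m \<and> 2 * a + b + 3 = 2 * M
      \<or> 2 * m + 1 \<le> b \<and> 2 * a + b + 1 = 2 * M"
  proof -
    (* The middle kind has a light stone because its weight is odd. *)
    have "1 \<le> b" if "2 * a + b + 3 = 2 * M"
      using that by presburger
    then show ?thesis
      using qm by (auto simp: pq cold_def M_def)
  qed
  consider "n = m" | "n = Suc m" | "Suc n \<le> m" | "Suc (Suc m) \<le> n"
    by linarith
  then show False
  proof cases
    case 1
    then have "M = N"
      by (simp add: N_def M_def)
    have "1 \<le> n"
    proof (rule ccontr)
      assume "\<not> 1 \<le> n"
      then have "n = 0" and "N = 1"
        by (simp_all add: N_def not_less_eq_eq)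
      then have "2 * x + y \<le> 1"
        using p_cases by auto
      then show False
        using mv by linarith
    qed
    then show False
      using p_cases q_cases mv \<open>M = N\<close> \<open>n = m\<close> by (elim disjE conjE) linarith+
  next
    case 2
    then have "N = 2 * M"
      by (simp add: N_def M_def)
    then show False
      using 2 p_cases q_cases mv by (elim disjE conjE) linarith+
  next
    case 3
    then have "(2::nat) ^ Suc n \<le> 2 ^ m"
      by (intro power_increasing) auto
    then have "2 * N \<le> M"
      by (simp add: N_def M_def)
    then show False
      using 3 p_cases q_cases mv N by (elim disjE conjE) linarith+
  next
    case 4
    then have "(2::nat) ^ Suc (Suc m) \<le> 2 ^ n"
      by (intro power_increasing) auto
    then have "4 * M \<le> N"
      by (simp add: N_def M_def)
    then show False
      using p_cases q_cases mv M by (elim disjE conjE) linarith+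
  qed
qed

text \<open>
  The cases compare the weight with \<open>4 * N = 2 ^ (n + 2)\<close>. In \<open>many_light\<close> and \<open>few_light\<close> the
  target lies in level \<open>n\<close> and keeps as many heavy stones as that level allows for the intended
  weight; in \<open>full\<close> and \<open>two\<close> it lies in level \<open>n + 1\<close>, and \<open>three\<close> is that level itself.
\<close>

lemma cold_absorbing:
  assumes out: "\<And>n. p \<notin> cold n"
  shows "\<exists>q\<in>move p. \<exists>n. q \<in> cold n"
proof -
  obtain x y where p: "p = (x, y)"
    by (cases p)
  have reach: ?thesis
    if "a \<le> x" "b \<le> y" "2 * a + b < 2 * x + y" "2 * x + y \<le> 2 * (2 * a + b)" "(a, b) \<in> cold m"
    for a b m
    using that mem_move_iff p by blast
  have "2 \<le> 2 * x + y"
    using out[of 0] unfolding p cold_0 by auto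
  then obtain n where n: "2 ^ Suc n \<le> 2 * x + y" "2 * x + y < 2 ^ Suc (Suc n)"
  proof -
    have "\<exists>k. 2 ^ k \<le> 2 * x + y \<and> 2 * x + y < 2 ^ (k + 1)"
      using ex_power_ivl1[of 2 "2 * x + y"] \<open>2 \<le> 2 * x + y\<close> by auto
    then obtain k where k: "2 ^ k \<le> 2 * x + y" "2 * x + y < 2 ^ (k + 1)"
      by blast
    with \<open>2 \<le> 2 * x + y\<close> have "k \<noteq> 0"
      by (intro notI) simp
    then obtain n where "k = Suc n"
      by (cases k) auto
    with k that show thesis
      by simp
  qed
  define N :: nat where "N = 2 ^ n"
  have N: "n + 1 \<le> N" "2 * N \<le> 2 * x + y" "2 * x + y < 4 * N"
    using n Suc_le_two_power[of n] by (simp_all add: N_def)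
  have cold_n: "(a, b) \<in> cold n \<longleftrightarrow> b = 0 \<and> a + 1 = N \<or>
      b + 3 \<le> 2 * n \<and> 2 * a + b + 3 = 2 * N \<or> 2 * n + 1 \<le> b \<and> 2 * a + b + 1 = 2 * N" for a b
    by (auto simp: cold_def N_def)
  have cold_Suc: "(a, b) \<in> cold (Suc n) \<longleftrightarrow> b = 0 \<and> a + 1 = 2 * N \<or>
      b + 1 \<le> 2 * n \<and> 2 * a + b + 3 = 4 * N \<or> 2 * n + 3 \<le> b \<and> 2 * a + b + 1 = 4 * N" for a b
    by (auto simp: cold_def N_def)
  note out = out[of "Suc n", unfolded p cold_Suc]
  consider (full) "2 * x + y + 1 = 4 * N"
    | (many_light) "2 * x + y + 2 \<le> 4 * N" "2 * n + 1 \<le> y"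
    | (few_light) "2 * x + y + 4 \<le> 4 * N" "y \<le> 2 * n"
    | (three) "2 * x + y + 3 = 4 * N" "y \<le> 2 * n"
    | (two) "2 * x + y + 2 = 4 * N" "y \<le> 2 * n"
    using N by linarith
  then show ?thesis
  proof cases
    case full
    then have odd: "odd y"
      by presburger
    show ?thesis
    proof (cases "y = 1")
      case True
      then show ?thesis
        using full N by (intro reach[of x 0 "Suc n"]) (auto simp: cold_Suc)
    next
      case False
      then have "3 \<le> y" and "y \<le> 2 * n + 1"
        using odd out full by presburger+
      then show ?thesis
        using full N by (intro reach[of x "y - 2" "Suc n"]) (auto simp: cold_Suc)
    qed
  next
    case many_light
    show ?thesis
    proof (cases "N \<le> x + n + 1")
      case True
      then show ?thesis
        using many_light N by (intro reach[of "N - 1 - n" "2 * n + 1" n]) (auto simp: cold_n)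
    next
      case False
      then show ?thesis
        using many_light N by (intro reach[of x "2 * N - 1 - 2 * x" n]) (auto simp: cold_n)
    qed
  next
    case few_light
    show ?thesis
    proof (cases "N \<le> x + 1")
      case True
      then show ?thesis
        using few_light N by (intro reach[of "N - 1" 0 n]) (auto simp: cold_n)
    next
      case False
      then show ?thesis
        using few_light N by (intro reach[of x "2 * N - 3 - 2 * x" n]) (auto simp: cold_n)
    qed
  next
    case three
    then have "odd y"
      by presburger
    then show ?thesis
      using three out by presburger
  next
    case two
    then have "even y" and "y \<noteq> 0"
      using out by presburger+
    then have "2 \<le> y"
      by presburger
    then show ?thesis
      using two N by (intro reach[of x "y - 1" "Suc n"]) (auto simp: cold_Suc)
  qed
qed

theorem theorem3p1:
  shows "{p. P_position p} = (\<Union>n\<in>{1..}. P1 n \<union> P2 n \<union> P3 n) \<union> {(0, 0), (0, 1)}"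
proof -
  have "{p. P_position p} = (\<Union>n. cold n)"
  proof (rule P_positions_eq_kernel)
    show "q \<notin> (\<Union>n. cold n)" if "p \<in> (\<Union>n. cold n)" and "q \<in> move p" for p q
      using that cold_stable by blast
    show "\<exists>q\<in>move p. q \<in> (\<Union>n. cold n)" if "p \<notin> (\<Union>n. cold n)" for p
      using that cold_absorbing[of p] by blast
  qed
  also have "\<dots> = (\<Union>n\<in>{1..}. cold n) \<union> cold 0"
  proof -
    have "UNIV = insert (0 :: nat) {1..}"
      by auto
    then show ?thesis
      by (metis UN_insert Un_commute)
  qed
  finally show ?thesis
    by (simp only: cold_eq cold_0)
qed

end
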